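(* Let $G=(V,E)$ be a digraph, and let $CG$ and $C^-G$ be the cone and the inverse cone defined by a vertex $a\notin V$. Then for every $v\in V$ and every $n\ge0$ there are isomorphisms $$\mathcal H_n^{[v,a]}(CG)\cong\mathcal H_{n-1}^{[v,\cdot]}(G),\qquad \mathcal H_n^{[a,v]}(C^-G)\cong\mathcal H_{n-1}^{[\cdot,v]}(G).$$ Let $SG$ and $S^-G$ be the suspension and the inverse suspension defined by vertices $a,b\notin V$, $a\neq b$. Then for every $v\in V$ and every $n\ge0$ there are isomorphisms $$\mathcal H_n^{[v,a]}(SG)\cong\mathcal H_n^{[v,b]}(SG)\cong\mathcal H_n^{[v,a]}(CG)\cong\mathcal H_{n-1}^{[v,\cdot]}(G),$$ $$\mathcal H_n^{[a,v]}(S^-G)\cong\mathcal H_n^{[b,v]}(S^-G)\cong\mathcal H_n^{[a,v]}(C^-G)\cong\mathcal H_{n-1}^{[\cdot,v]}(G).$$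
   Context: Fix a commutative ring $R$ with unit. A digraph $G=(V,E)$ is a finite nonempty set $V$ of vertices with a set $E$ of ordered pairs $(v,w)$ of distinct vertices, written $v\to w$ (arrows). Cones and suspensions: $CG$ is obtained from $G$ by adding a new vertex $a$ and arrows $v\to a$ for all $v\in V$; $C^-G$ by adding a new vertex $a$ and arrows $a\to v$ for all $v\in V$; $SG$ by adding two new vertices $a,b$ and arrows $v\to a$, $v\to b$ for all $v\in V$; $S^-G$ by adding two new vertices $a,b$ and arrows $a\to v$, $b\to v$ for all $v\in V$. For a finite set $V$ and $n\ge0$, $\Lambda_n(V)$ is the free $R$-module with basis $e_{i_0\dots i_n}$, over all sequences $(i_0,\dots,i_n)$ of elements of $V$. $e_{i_0\dots i_n}$ is allowed in $G$ if $(i_k\to i_{k+1})\in E$ for all $0\le k\le n-1$ (every $e_{i_0}$ is allowed); its tail is $i_0$ and its head is $i_n$. Cluster homology: for $x,y\in V$ and $n\ge1$, $\Lambda_n^{[x,y]}(V)\subset\Lambda_n(V)$ is the free submodule generated by elementary $n$-paths with tail $x$ and head $y$; $\Lambda_0^{[x,y]}=0$. The differential is $d(e_{xi_0\dots i_{n-2}y})=\sum_{m=0}^{n-2}(-1)^me_{xi_0\dots\widehat{i_m}\dots i_{n-2}y}$ for $n\ge2$, $d=0$ for $n=1$. $\mathcal A_n^{[x,y]}(G)$ is the submodule generated by allowed such paths for $n\ge1$; $\mathcal A_0^{[x,y]}(G)=0$. $\Theta_n^{[x,y]}(G)=\{w\in\mathcal A_n^{[x,y]}(G)\mid d(w)\in\mathcal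 A_{n-1}^{[x,y]}(G)\}$ for $n\ge1$, $\Theta_0^{[x,y]}=0$; $\mathcal H_n^{[x,y]}(G)$ is the $n$-th homology of $(\Theta_*^{[x,y]}(G),d)$. Tail and head homology: for $x\in V$ and $n\ge0$, $\Lambda_n^{[x,\cdot]}(V)$ (resp. $\Lambda_n^{[\cdot,x]}(V)$) is the free submodule of $\Lambda_n(V)$ generated by elementary $n$-paths with tail $x$ (resp. head $x$), and both are $0$ for $n=-1$. Differentials: $d^t(e_{xi_0\dots i_{n-1}})=\sum_{m=0}^{n-1}(-1)^me_{xi_0\dots\widehat{i_m}\dots i_{n-1}}$ and $d^h(e_{i_0\dots i_{n-1}x})=\sum_{m=0}^{n-1}(-1)^me_{i_0\dots\widehat{i_m}\dots i_{n-1}x}$ for $n\ge1$, and both are $0$ for $n=0$. $\mathcal A_n^{[x,\cdot]}(G)$, $\mathcal A_n^{[\cdot,x]}(G)$ are the submodules generated by allowed such paths ($0$ for $n=-1$). $\Theta_n^{[x,\cdot]}(G)=\{w\in\mathcal A_n^{[x,\cdot]}(G)\mid d^t(w)\in\mathcal A_{n-1}^{[x,\cdot]}(G)\}$ and $\Theta_n^{[\cdot,x]}(G)=\{w\in\mathcal A_n^{[\cdot,x]}(G)\mid d^h(w)\in\mathcal A_{n-1}^{[\cdot,x]}(G)\}$ for $n\ge0$, $0$ for $n=-1$. $\mathcal H_n^{[x,\cdot]}(G)$ and $\mathcal H_n^{[\cdot,x]}(G)$ are the homology groups of these complexes, with $\mathcal H_{-1}=0$. *)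

theory Defs
  imports "HOL-Algebra.Module" "HOL-Algebra.AbelCoset" "Graph_Theory.Pair_Digraph"
begin

(* shadows the record field mult of HOL-Algebra *)
hide_const (open) Multiset.mult

section \<open>Free modules, quotient modules, isomorphism\<close>

text \<open>
  The free module on a set of basis elements consists of the finitely supported functions
  vanishing off that set.  The operations do not depend on the basis set, so that a subset of the
  basis literally generates a submodule.  The fields \<open>mult\<close> and \<open>one\<close>, which the record
  type \<open>module\<close> inherits from \<open>ring\<close>, carry no meaning for modules.
\<close>

definition free_module :: "('r, 'm) ring_scheme \<Rightarrow> 'b set \<Rightarrow> ('r, 'b \<Rightarrow> 'r) module" where
  "free_module R B =
     \<lparr> carrier = {w. (\<forall>p. w p \<in> carrier R) \<and> finite {p. w p \<noteq> \<zero>\<^bsub>R\<^esub>} \<and>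
                     (\<forall>p. p \<notin> B \<longrightarrow> w p = \<zero>\<^bsub>R\<^esub>)},
       mult = undefined, one = undefined,
       zero = (\<lambda>p. \<zero>\<^bsub>R\<^esub>),
       add = (\<lambda>w w' p. w p \<oplus>\<^bsub>R\<^esub> w' p),
       smult = (\<lambda>r w p. r \<otimes>\<^bsub>R\<^esub> w p) \<rparr>"

definition basis_elem :: "('r, 'm) ring_scheme \<Rightarrow> 'b \<Rightarrow> 'b \<Rightarrow> 'r" where
  "basis_elem R p = (\<lambda>q. if q = p then \<one>\<^bsub>R\<^esub> else \<zero>\<^bsub>R\<^esub>)"

text \<open>Linear extension to a free module of a map \<open>f\<close> given on the basis, with target \<open>M\<close>.\<close>

definition lin_ext ::
    "('r, 'm) ring_scheme \<Rightarrow> ('r, 'c, 'k) module_scheme \<Rightarrow> ('b \<Rightarrow> 'c) \<Rightarrow> ('b \<Rightarrow> 'r) \<Rightarrow> 'c" where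
  "lin_ext R M f w = (\<Oplus>\<^bsub>M\<^esub>p\<in>{p. w p \<noteq> \<zero>\<^bsub>R\<^esub>}. w p \<odot>\<^bsub>M\<^esub> f p)"

definition quot_module ::
    "('r, 'c, 'k) module_scheme \<Rightarrow> 'c set \<Rightarrow> ('r, 'c set) module" where
  "quot_module M N =
     \<lparr> carrier = a_rcosets\<^bsub>M\<^esub> N,
       mult = undefined, one = undefined,
       zero = N,
       add = set_add M,
       smult = (\<lambda>r C. \<Union>x\<in>C. N +>\<^bsub>M\<^esub> (r \<odot>\<^bsub>M\<^esub> x)) \<rparr>"

definition mod_isomorphic ::
    "('r, 'm) ring_scheme \<Rightarrow> ('r, 'c, 'k) module_scheme \<Rightarrow> ('r, 'd, 'l) module_scheme \<Rightarrow> bool" where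
  "mod_isomorphic R M N \<longleftrightarrow>
     (\<exists>h \<in> iso (add_monoid M) (add_monoid N).
        \<forall>r \<in> carrier R. \<forall>x \<in> carrier M. h (r \<odot>\<^bsub>M\<^esub> x) = r \<odot>\<^bsub>N\<^esub> h x)"

section \<open>Complexes\<close>

text \<open>
  Degrees are integers.  \<open>A\<close> is a graded submodule of the domain of a differential \<open>d\<close>, where
  \<open>d n\<close> goes from degree \<open>n\<close> to degree \<open>n - 1\<close>; \<open>Theta A d\<close> is the subcomplex
  of those elements of \<open>A\<close> whose differential is again in \<open>A\<close>.
\<close>

definition Theta ::
    "(int \<Rightarrow> ('r, 'c) module) \<Rightarrow> (int \<Rightarrow> 'c \<Rightarrow> 'c) \<Rightarrow> int \<Rightarrow> ('r, 'c) module" where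
  "Theta A d n = (A n)\<lparr>carrier := {w \<in> carrier (A n). d n w \<in> carrier (A (n - 1))}\<rparr>"

definition homology ::
    "(int \<Rightarrow> ('r, 'c) module) \<Rightarrow> (int \<Rightarrow> 'c \<Rightarrow> 'c) \<Rightarrow> int \<Rightarrow> ('r, 'c set) module" where
  "homology C d n =
     quot_module ((C n)\<lparr>carrier := {w \<in> carrier (C n). d n w = \<zero>\<^bsub>C (n - 1)\<^esub>}\<rparr>)
       (d (n + 1) ` carrier (C (n + 1)))"

section \<open>Paths in digraphs\<close>

text \<open>
  A digraph is a \<open>pair_digraph\<close>: finitely many vertices, arrows are ordered pairs of distinct
  vertices.  The elementary \<open>n\<close>-path with vertices \<open>i\<^sub>0, \<dots>, i\<^sub>n\<close> is the list
  of length \<open>n + 1\<close>; its tail is \<open>hd\<close> and its head is \<open>last\<close>.  There are none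
  in negative degree.
\<close>

definition elem_paths :: "'v set \<Rightarrow> int \<Rightarrow> 'v list set" where
  "elem_paths V n = {p. p \<noteq> [] \<and> set p \<subseteq> V \<and> int (length p) = n + 1}"

definition allowed_paths :: "'v pair_pre_digraph \<Rightarrow> int \<Rightarrow> 'v list set" where
  "allowed_paths G n =
     {p \<in> elem_paths (pverts G) n. successively (\<lambda>u w. (u, w) \<in> parcs G) p}"

definition omit :: "nat \<Rightarrow> 'v list \<Rightarrow> 'v list" where
  "omit k p = take k p @ drop (Suc k) p"

definition alt_sign :: "('r, 'm) ring_scheme \<Rightarrow> nat \<Rightarrow> 'r" where
  "alt_sign R m = (\<ominus>\<^bsub>R\<^esub> \<one>\<^bsub>R\<^esub>) [^]\<^bsub>R\<^esub> m"

section \<open>Cluster homology\<close>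

text \<open>The condition \<open>1 \<le> n\<close> matters for \<open>x = y\<close>: the \<open>0\<close>-path \<open>[x]\<close> is excluded.\<close>

definition Lambda_cluster ::
    "('r, 'm) ring_scheme \<Rightarrow> 'v set \<Rightarrow> 'v \<Rightarrow> 'v \<Rightarrow> int \<Rightarrow> ('r, 'v list \<Rightarrow> 'r) module" where
  "Lambda_cluster R V x y n =
     free_module R {p \<in> elem_paths V n. 1 \<le> n \<and> hd p = x \<and> last p = y}"

text \<open>
  In \<open>x i\<^sub>0 \<dots> i\<^bsub>n-2\<^esub> y\<close> the vertex \<open>i\<^sub>m\<close> is at position \<open>m + 1\<close>,
  and \<open>n - 1 = length p - 2\<close>; for \<open>n = 1\<close> the sum is empty.
\<close>

definition d_cluster ::
    "('r, 'm) ring_scheme \<Rightarrow> 'v set \<Rightarrow> 'v \<Rightarrow> 'v \<Rightarrow> int \<Rightarrow> ('v list \<Rightarrow> 'r) \<Rightarrow> ('v list \<Rightarrow> 'r)" where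
  "d_cluster R V x y n =
     (let M = Lambda_cluster R V x y (n - 1) in
      lin_ext R M (\<lambda>p. \<Oplus>\<^bsub>M\<^esub>m\<in>{..<length p - 2}.
        alt_sign R m \<odot>\<^bsub>M\<^esub> basis_elem R (omit (Suc m) p)))"

definition A_cluster ::
    "('r, 'm) ring_scheme \<Rightarrow> 'v pair_pre_digraph \<Rightarrow> 'v \<Rightarrow> 'v \<Rightarrow> int \<Rightarrow> ('r, 'v list \<Rightarrow> 'r) module" where
  "A_cluster R G x y n =
     free_module R {p \<in> allowed_paths G n. 1 \<le> n \<and> hd p = x \<and> last p = y}"

definition H_cluster ::
    "('r, 'm) ring_scheme \<Rightarrow> 'v pair_pre_digraph \<Rightarrow> 'v \<Rightarrow> 'v \<Rightarrow> int
       \<Rightarrow> ('r, ('v list \<Rightarrow> 'r) set) module" where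
  "H_cluster R G x y =
     homology (Theta (A_cluster R G x y) (d_cluster R (pverts G) x y))
       (d_cluster R (pverts G) x y)"

section \<open>Tail homology and head homology\<close>

definition Lambda_tail ::
    "('r, 'm) ring_scheme \<Rightarrow> 'v set \<Rightarrow> 'v \<Rightarrow> int \<Rightarrow> ('r, 'v list \<Rightarrow> 'r) module" where
  "Lambda_tail R V x n = free_module R {p \<in> elem_paths V n. hd p = x}"

definition Lambda_head ::
    "('r, 'm) ring_scheme \<Rightarrow> 'v set \<Rightarrow> 'v \<Rightarrow> int \<Rightarrow> ('r, 'v list \<Rightarrow> 'r) module" where
  "Lambda_head R V x n = free_module R {p \<in> elem_paths V n. last p = x}"

text \<open>
  The vertex \<open>i\<^sub>m\<close> is at position \<open>m + 1\<close> of \<open>x i\<^sub>0 \<dots> i\<^bsub>n-1\<^esub>\<close> and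
  at position \<open>m\<close> of \<open>i\<^sub>0 \<dots> i\<^bsub>n-1\<^esub> x\<close>; for \<open>n = 0\<close> the sums are
  empty.
\<close>

definition d_tail ::
    "('r, 'm) ring_scheme \<Rightarrow> 'v set \<Rightarrow> 'v \<Rightarrow> int \<Rightarrow> ('v list \<Rightarrow> 'r) \<Rightarrow> ('v list \<Rightarrow> 'r)" where
  "d_tail R V x n =
     (let M = Lambda_tail R V x (n - 1) in
      lin_ext R M (\<lambda>p. \<Oplus>\<^bsub>M\<^esub>m\<in>{..<length p - 1}.
        alt_sign R m \<odot>\<^bsub>M\<^esub> basis_elem R (omit (Suc m) p)))"

definition d_head ::
    "('r, 'm) ring_scheme \<Rightarrow> 'v set \<Rightarrow> 'v \<Rightarrow> int \<Rightarrow> ('v list \<Rightarrow> 'r) \<Rightarrow> ('v list \<Rightarrow> 'r)" where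
  "d_head R V x n =
     (let M = Lambda_head R V x (n - 1) in
      lin_ext R M (\<lambda>p. \<Oplus>\<^bsub>M\<^esub>m\<in>{..<length p - 1}.
        alt_sign R m \<odot>\<^bsub>M\<^esub> basis_elem R (omit m p)))"

definition A_tail ::
    "('r, 'm) ring_scheme \<Rightarrow> 'v pair_pre_digraph \<Rightarrow> 'v \<Rightarrow> int \<Rightarrow> ('r, 'v list \<Rightarrow> 'r) module" where
  "A_tail R G x n = free_module R {p \<in> allowed_paths G n. hd p = x}"

definition A_head ::
    "('r, 'm) ring_scheme \<Rightarrow> 'v pair_pre_digraph \<Rightarrow> 'v \<Rightarrow> int \<Rightarrow> ('r, 'v list \<Rightarrow> 'r) module" where
  "A_head R G x n = free_module R {p \<in> allowed_paths G n. last p = x}"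

definition H_tail ::
    "('r, 'm) ring_scheme \<Rightarrow> 'v pair_pre_digraph \<Rightarrow> 'v \<Rightarrow> int
       \<Rightarrow> ('r, ('v list \<Rightarrow> 'r) set) module" where
  "H_tail R G x =
     homology (Theta (A_tail R G x) (d_tail R (pverts G) x)) (d_tail R (pverts G) x)"

definition H_head ::
    "('r, 'm) ring_scheme \<Rightarrow> 'v pair_pre_digraph \<Rightarrow> 'v \<Rightarrow> int
       \<Rightarrow> ('r, ('v list \<Rightarrow> 'r) set) module" where
  "H_head R G x =
     homology (Theta (A_head R G x) (d_head R (pverts G) x)) (d_head R (pverts G) x)"

section \<open>Cones and suspensions\<close>

text \<open>The new vertices are parameters; they are meant to lie outside \<open>pverts G\<close> and to be distinct.\<close>

definition cone :: "'v \<Rightarrow> 'v pair_pre_digraph \<Rightarrow> 'v pair_pre_digraph" where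
  "cone a G = \<lparr> pverts = insert a (pverts G), parcs = parcs G \<union> pverts G \<times> {a} \<rparr>"

definition inv_cone :: "'v \<Rightarrow> 'v pair_pre_digraph \<Rightarrow> 'v pair_pre_digraph" where
  "inv_cone a G = \<lparr> pverts = insert a (pverts G), parcs = parcs G \<union> {a} \<times> pverts G \<rparr>"

definition suspension :: "'v \<Rightarrow> 'v \<Rightarrow> 'v pair_pre_digraph \<Rightarrow> 'v pair_pre_digraph" where
  "suspension a b G =
     \<lparr> pverts = insert a (insert b (pverts G)), parcs = parcs G \<union> pverts G \<times> {a, b} \<rparr>"

definition inv_suspension :: "'v \<Rightarrow> 'v \<Rightarrow> 'v pair_pre_digraph \<Rightarrow> 'v pair_pre_digraph" where
  "inv_suspension a b G =
     \<lparr> pverts = insert a (insert b (pverts G)), parcs = parcs G \<union> {a, b} \<times> pverts G \<rparr>"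

end

theory Submission
  imports Defs
begin

text \<open>
  Since a new vertex has no outgoing arrows, the allowed paths of \<open>CG\<close> or \<open>SG\<close> from
  \<open>v\<close> to a new vertex \<open>a\<close> are exactly the paths \<open>q a\<close> with \<open>q\<close> allowed in
  \<open>G\<close> and starting at \<open>v\<close>, and deleting an inner vertex of \<open>q a\<close> is the same as
  deleting a vertex of \<open>q\<close> other than the first, with the same sign.  So all the complexes are
  related by relabelling basis paths compatibly with faces.  Such a relabelling maps cosets of
  boundaries to cosets of boundaries, and \<open>d\<^sup>2 = 0\<close> never enters.  The inverse constructions are
  dual.
\<close>

section \<open>Free modules and quotients\<close>

text \<open>Since \<open>add\<close> and \<open>zero\<close> of \<open>free_module\<close> are
  pointwise, evaluation at \<open>q\<close> turns sums in the module into sums in \<open>R\<close>.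
  All module-valued sums below are reduced to scalars in this way.\<close>

lemma finsum_free_module:
  fixes R :: "('r, 'm) ring_scheme" and B :: "'b set"
  assumes "cring R" "\<And>i. i \<in> I \<Longrightarrow> f i \<in> carrier (free_module R B)" "finite I"
  shows "(\<Oplus>\<^bsub>free_module R B\<^esub>i\<in>I. f i) \<in> carrier (free_module R B)"
    and "(\<Oplus>\<^bsub>free_module R B\<^esub>i\<in>I. f i) q = (\<Oplus>\<^bsub>R\<^esub>i\<in>I. f i q)"
proof -
  interpret R: cring R by fact
  have fin: "finite {p. w p \<oplus>\<^bsub>R\<^esub> w' p \<noteq> \<zero>\<^bsub>R\<^esub>}"
    if "finite {p. w p \<noteq> \<zero>\<^bsub>R\<^esub>}" "finite {p. w' p \<noteq> \<zero>\<^bsub>R\<^esub>}" for w w' :: "'b \<Rightarrow> 'r"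
    by (rule finite_subset[OF _ finite_UnI[OF that]]) auto
  \<comment> \<open>This makes the \<open>finsum\<close> rules available for the free module. By
    \<open>fin\<close>, addition preserves finite support, as the support of a sum lies in the union
    of the supports.\<close>
  interpret M: abelian_monoid "free_module R B"
    by (rule abelian_monoidI) (use fin in \<open>auto simp: free_module_def R.a_ac\<close>)
  have "(\<Oplus>\<^bsub>free_module R B\<^esub>i\<in>I. f i) \<in> carrier (free_module R B) \<and>
        (\<Oplus>\<^bsub>free_module R B\<^esub>i\<in>I. f i) q = (\<Oplus>\<^bsub>R\<^esub>i\<in>I. f i q)"
    using assms(3,2)
  proof (induction I)
    case empty
    show ?case unfolding M.finsum_empty R.finsum_empty by (simp add: free_module_def)
  next
    case (insert i I)
    then have 1: "f \<in> I \<rightarrow> carrier (free_module R B)" "f i \<in> carrier (free_module R B)" by auto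
    then have 2: "(\<lambda>i. f i q) \<in> I \<rightarrow> carrier R" "f i q \<in> carrier R"
      by (auto simp: free_module_def)
    have "(\<Oplus>\<^bsub>free_module R B\<^esub>i\<in>I. f i) q = (\<Oplus>\<^bsub>R\<^esub>i\<in>I. f i q)"
      using insert by auto
    then show ?case
      using insert.hyps 1 2 M.finsum_closed[of f "insert i I"]
      by (auto simp: M.finsum_insert R.finsum_insert) (simp add: free_module_def)
  qed
  then show "(\<Oplus>\<^bsub>free_module R B\<^esub>i\<in>I. f i) \<in> carrier (free_module R B)"
    and "(\<Oplus>\<^bsub>free_module R B\<^esub>i\<in>I. f i) q = (\<Oplus>\<^bsub>R\<^esub>i\<in>I. f i q)" by auto
qed

lemma smult_free_module_closed:
  assumes "cring R" "r \<in> carrier R" "w \<in> carrier (free_module R B)"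
  shows "r \<odot>\<^bsub>free_module R B\<^esub> w \<in> carrier (free_module R B)"
proof -
  interpret R: cring R by fact
  show ?thesis
    using assms(2,3)
    by (auto simp: free_module_def elim!: rev_finite_subset)
qed

lemma alt_sign_closed: "cring R \<Longrightarrow> alt_sign R m \<in> carrier R"
  unfolding alt_sign_def
  by (meson abelian_group.a_inv_closed cring.axioms(1) monoid.nat_pow_closed ring.ring_simprules(6)
      ring_def)

lemma basis_elem_closed: "cring R \<Longrightarrow> basis_elem R p q \<in> carrier R"
  by (simp add: basis_elem_def cring.cring_simprules)

lemma basis_elem_carrier:
  "cring R \<Longrightarrow> p \<in> B \<Longrightarrow> basis_elem R p \<in> carrier (free_module R B)"
  by (auto simp: free_module_def basis_elem_def cring.cring_simprules)

section \<open>Cosets and isomorphic quotients\<close>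

lemma a_rcosets_eq_image: "a_rcosets\<^bsub>M\<^esub> N = (\<lambda>x. N +>\<^bsub>M\<^esub> x) ` carrier M"
  by (auto simp: A_RCOSETS_def')

text \<open>Since \<open>d\<^sup>2 = 0\<close> is not used, the boundaries \<open>N\<close> are not known to lie among the
  cycles \<open>carrier M\<close>; hence the larger set \<open>S\<close>.\<close>

lemma quot_module_isomorphic:
  assumes f: "bij_betw f (carrier M) (carrier M')" and N: "f ` N = N'"
    and S: "carrier M \<subseteq> S" "N \<subseteq> S" "inj_on f S"
    and add: "\<And>x y. x \<in> S \<Longrightarrow> y \<in> S \<Longrightarrow> x \<oplus>\<^bsub>M\<^esub> y \<in> S \<and> f (x \<oplus>\<^bsub>M\<^esub> y) = f x \<oplus>\<^bsub>M'\<^esub> f y"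
    and smult: "\<And>r x. r \<in> carrier R \<Longrightarrow> x \<in> S \<Longrightarrow>
                  r \<odot>\<^bsub>M\<^esub> x \<in> S \<and> f (r \<odot>\<^bsub>M\<^esub> x) = r \<odot>\<^bsub>M'\<^esub> f x"
  shows "mod_isomorphic R (quot_module M N) (quot_module M' N')"
proof -
  have coset: "f ` (N +>\<^bsub>M\<^esub> x) = N' +>\<^bsub>M'\<^esub> f x" if "x \<in> S" for x
  proof -
    have "f ` (N +>\<^bsub>M\<^esub> x) = (\<lambda>y. f (y \<oplus>\<^bsub>M\<^esub> x)) ` N"
      by (auto simp: a_r_coset_def')
    also have "\<dots> = (\<lambda>y. f y \<oplus>\<^bsub>M'\<^esub> f x) ` N"
      using that S(2) add by (intro image_cong) auto
    finally show ?thesis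
      by (auto simp: a_r_coset_def' N[symmetric])
  qed
  \<comment> \<open>Cosets stay inside \<open>S\<close>, where \<open>f\<close> is injective, so
    taking images of cosets is injective too.\<close>
  have sub: "C \<subseteq> S" if "C \<in> a_rcosets\<^bsub>M\<^esub> N" for C
    using that S(1,2) add by (auto simp: A_RCOSETS_def' a_r_coset_def')
  have "bij_betw ((`) f) (a_rcosets\<^bsub>M\<^esub> N) (a_rcosets\<^bsub>M'\<^esub> N')"
  proof (rule bij_betw_imageI)
    show "inj_on ((`) f) (a_rcosets\<^bsub>M\<^esub> N)"
      using sub inj_on_image_eq_iff[OF S(3)] by (auto intro!: inj_onI)
    show "(`) f ` (a_rcosets\<^bsub>M\<^esub> N) = a_rcosets\<^bsub>M'\<^esub> N'"
    proof -
      have "(`) f ` (a_rcosets\<^bsub>M\<^esub> N) = (\<lambda>x. N' +>\<^bsub>M'\<^esub> f x) ` carrier M"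
        unfolding a_rcosets_eq_image image_image using S(1) by (intro image_cong coset) auto
      then show ?thesis
        by (simp add: a_rcosets_eq_image bij_betw_imp_surj_on[OF f, symmetric] image_image)
    qed
  qed
  moreover have "f ` (C <+>\<^bsub>M\<^esub> D) = f ` C <+>\<^bsub>M'\<^esub> f ` D"
    if "C \<in> a_rcosets\<^bsub>M\<^esub> N" "D \<in> a_rcosets\<^bsub>M\<^esub> N" for C D
  proof -
    have "f ` (C <+>\<^bsub>M\<^esub> D) = (\<Union>x\<in>C. (\<lambda>y. f (x \<oplus>\<^bsub>M\<^esub> y)) ` D)"
      by (auto simp: set_add_def')
    also have "\<dots> = (\<Union>x\<in>C. (\<lambda>y. f x \<oplus>\<^bsub>M'\<^esub> f y) ` D)"
      using sub[OF that(1)] sub[OF that(2)] add by (intro SUP_cong image_cong) auto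
    finally show ?thesis
      by (auto simp: set_add_def')
  qed
  moreover have "f ` (\<Union>x\<in>C. N +>\<^bsub>M\<^esub> (r \<odot>\<^bsub>M\<^esub> x)) = (\<Union>x\<in>f ` C. N' +>\<^bsub>M'\<^esub> (r \<odot>\<^bsub>M'\<^esub> x))"
    if "C \<in> a_rcosets\<^bsub>M\<^esub> N" "r \<in> carrier R" for C r
    using sub[OF that(1)] that(2) coset smult by (simp add: image_UN subset_iff)
  \<comment> \<open>The isomorphism sends a coset to its image under \<open>f\<close>. Sum and
    scalar action of cosets are set operations, so they commute with images without any choice of
    representatives.\<close>
  ultimately show ?thesis
    unfolding mod_isomorphic_def iso_def hom_def
    by (intro bexI[where x = "(`) f"]) (auto simp: quot_module_def bij_betw_def)
qed

section \<open>Relabelling of bases\<close>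

text \<open>Common shape of the cluster, tail and head differentials: \<open>k p\<close> counts the
  faces of \<open>p\<close>, and \<open>face m p\<close> is the face carrying the sign
  \<open>alt_sign R m\<close>. Values are computed in \<open>R\<close> with no mention of degree or
  target module, so that differentials on different bases can be compared directly.\<close>

definition face_diff ::
    "('r, 'm) ring_scheme \<Rightarrow> ('b \<Rightarrow> nat) \<Rightarrow> (nat \<Rightarrow> 'b \<Rightarrow> 'b) \<Rightarrow> ('b \<Rightarrow> 'r) \<Rightarrow> 'b \<Rightarrow> 'r" where
  "face_diff R k face w q =
     (\<Oplus>\<^bsub>R\<^esub>p\<in>{p. w p \<noteq> \<zero>\<^bsub>R\<^esub>}. w p \<otimes>\<^bsub>R\<^esub>
        (\<Oplus>\<^bsub>R\<^esub>m\<in>{..<k p}. alt_sign R m \<otimes>\<^bsub>R\<^esub> basis_elem R (face m p) q))"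

text \<open>Both layers of sums in the target are evaluated pointwise by
  \<open>finsum_free_module\<close>. That lemma asks for summands in the carrier, which is why all
  faces must lie in \<open>L\<close>.\<close>

lemma lin_ext_eq_face_diff:
  assumes R: "cring R" and w: "w \<in> carrier (free_module R B)"
    and face: "\<And>p m. p \<in> B \<Longrightarrow> m < k p \<Longrightarrow> face m p \<in> L"
  shows "lin_ext R (free_module R L)
           (\<lambda>p. \<Oplus>\<^bsub>free_module R L\<^esub>m\<in>{..<k p}.
              alt_sign R m \<odot>\<^bsub>free_module R L\<^esub> basis_elem R (face m p)) w
         = face_diff R k face w"
proof
  fix q
  let ?M = "free_module R L"
  let ?s = "\<lambda>p m. alt_sign R m \<odot>\<^bsub>?M\<^esub> basis_elem R (face m p)"
  let ?supp = "{p. w p \<noteq> \<zero>\<^bsub>R\<^esub>}"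
  have wB: "p \<in> B" if "p \<in> ?supp" for p
    using w that by (auto simp: free_module_def)
  have wR: "w p \<in> carrier R" for p
    using w by (auto simp: free_module_def)
  have fin: "finite ?supp"
    using w by (auto simp: free_module_def)
  have s: "?s p m \<in> carrier ?M" if "p \<in> ?supp" "m \<in> {..<k p}" for p m
    using that face[OF wB]
    by (intro smult_free_module_closed basis_elem_carrier alt_sign_closed R) auto
  have sq: "(\<Oplus>\<^bsub>?M\<^esub>m\<in>{..<k p}. ?s p m) q
            = (\<Oplus>\<^bsub>R\<^esub>m\<in>{..<k p}. alt_sign R m \<otimes>\<^bsub>R\<^esub> basis_elem R (face m p) q)"
    if "p \<in> ?supp" for p
    using finsum_free_module(2)[OF R s[OF that] finite_lessThan] by (simp add: free_module_def)
  have c: "w p \<odot>\<^bsub>?M\<^esub> (\<Oplus>\<^bsub>?M\<^esub>m\<in>{..<k p}. ?s p m) \<in> carrier ?M"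
    if "p \<in> ?supp" for p
    using finsum_free_module(1)[OF R s[OF that] finite_lessThan]
    by (rule smult_free_module_closed[OF R wR])
  have "lin_ext R ?M (\<lambda>p. \<Oplus>\<^bsub>?M\<^esub>m\<in>{..<k p}. ?s p m) w q
        = (\<Oplus>\<^bsub>R\<^esub>p\<in>?supp. (w p \<odot>\<^bsub>?M\<^esub> (\<Oplus>\<^bsub>?M\<^esub>m\<in>{..<k p}. ?s p m)) q)"
    unfolding lin_ext_def by (rule finsum_free_module(2)[OF R c fin])
  also have "\<dots> = (\<Oplus>\<^bsub>R\<^esub>p\<in>?supp. w p \<otimes>\<^bsub>R\<^esub>
      (\<Oplus>\<^bsub>R\<^esub>m\<in>{..<k p}. alt_sign R m \<otimes>\<^bsub>R\<^esub> basis_elem R (face m p) q))"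
  proof (rule abelian_monoid.finsum_cong')
    show "abelian_monoid R"
      using R by (simp add: cring.axioms ring.axioms abelian_group.axioms)
    show "(\<lambda>p. w p \<otimes>\<^bsub>R\<^esub> (\<Oplus>\<^bsub>R\<^esub>m\<in>{..<k p}.
             alt_sign R m \<otimes>\<^bsub>R\<^esub> basis_elem R (face m p) q)) \<in> ?supp \<rightarrow> carrier R"
    proof -
      interpret R: cring R by fact
      show ?thesis
        using wR R by (auto intro!: R.m_closed R.finsum_closed alt_sign_closed basis_elem_closed)
    qed
    show "(w p \<odot>\<^bsub>?M\<^esub> (\<Oplus>\<^bsub>?M\<^esub>m\<in>{..<k p}. ?s p m)) q = w p \<otimes>\<^bsub>R\<^esub>
      (\<Oplus>\<^bsub>R\<^esub>m\<in>{..<k p}. alt_sign R m \<otimes>\<^bsub>R\<^esub> basis_elem R (face m p) q)"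
      if "p \<in> ?supp" for p
      by (subst sq[OF that, symmetric]) (simp add: free_module_def)
  qed simp
  finally show "lin_ext R ?M (\<lambda>p. \<Oplus>\<^bsub>?M\<^esub>m\<in>{..<k p}. ?s p m) w q = face_diff R k face w q"
    by (simp add: face_diff_def)
qed

lemma finsum_all_zero:
  assumes "cring R" "\<And>i. i \<in> I \<Longrightarrow> f i = \<zero>\<^bsub>R\<^esub>"
  shows "(\<Oplus>\<^bsub>R\<^esub>i\<in>I. f i) = \<zero>\<^bsub>R\<^esub>"
proof -
  interpret cring R by fact
  show ?thesis using assms(2) by (rule add.finprod_one_eqI)
qed

text \<open>A bijection of bases that intertwines the number of faces and the faces themselves. It
  goes from \<open>L'\<close> to \<open>L\<close> because coefficient functions pull back. The sets
  \<open>L\<close> and \<open>L'\<close> mix all degrees; grading and allowedness enter later as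
  subsets of them.\<close>

locale relabelling =
  fixes R :: "('r, 'm) ring_scheme"
    and L :: "'b set" and k :: "'b \<Rightarrow> nat" and face :: "nat \<Rightarrow> 'b \<Rightarrow> 'b"
    and L' :: "'c set" and k' :: "'c \<Rightarrow> nat" and face' :: "nat \<Rightarrow> 'c \<Rightarrow> 'c"
    and g :: "'c \<Rightarrow> 'b"
  assumes cring: "cring R"
    and bij: "bij_betw g L' L"
    and k: "q \<in> L' \<Longrightarrow> k (g q) = k' q"
    and face'_closed: "q \<in> L' \<Longrightarrow> m < k' q \<Longrightarrow> face' m q \<in> L'"
    and face: "q \<in> L' \<Longrightarrow> m < k' q \<Longrightarrow> face m (g q) = g (face' m q)"
begin

definition pull :: "('b \<Rightarrow> 'r) \<Rightarrow> 'c \<Rightarrow> 'r" where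
  "pull w q = (if q \<in> L' then w (g q) else \<zero>\<^bsub>R\<^esub>)"

text \<open>The ambient set \<open>S\<close> for \<open>quot_module_isomorphic\<close>:
  \<open>pull\<close> is injective on it, and it is closed under the module operations and
  \<open>face_diff\<close>. Its conditions are pointwise; over an infinite support
  \<open>finsum\<close> is zero by convention.\<close>

definition supported :: "('b \<Rightarrow> 'r) set" where
  "supported = {w. (\<forall>p. w p \<in> carrier R) \<and> (\<forall>p. p \<notin> L \<longrightarrow> w p = \<zero>\<^bsub>R\<^esub>)}"

lemma g_in: "q \<in> L' \<Longrightarrow> g q \<in> L"
  using bij by (auto simp: bij_betw_def)

lemma inj_on_pull: "inj_on pull supported"
proof (rule inj_onI, rule ext)
  fix w w' p assume "w \<in> supported" "w' \<in> supported" and eq: "pull w = pull w'"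
  show "w p = w' p"
  proof (cases "p \<in> L")
    case True
    then obtain q where "q \<in> L'" "p = g q" using bij by (auto simp: bij_betw_def)
    then show ?thesis using fun_cong[OF eq, of q] by (simp add: pull_def)
  qed (use \<open>w \<in> supported\<close> \<open>w' \<in> supported\<close> in \<open>auto simp: supported_def\<close>)
qed

lemma free_module_supported: "B \<subseteq> L \<Longrightarrow> carrier (free_module R B) \<subseteq> supported"
  by (auto simp: free_module_def supported_def)

text \<open>Injectivity is inherited from \<open>supported\<close>. For surjectivity, a function on
  \<open>L'\<close> is pushed forward along the inverse of \<open>g\<close>; both passages preserve
  finite support because \<open>g\<close> is bijective.\<close>

lemma bij_betw_pull:
  assumes B: "B \<subseteq> L" "B' \<subseteq> L'" "\<And>q. q \<in> L' \<Longrightarrow> g q \<in> B \<longleftrightarrow> q \<in> B'"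
  shows "bij_betw pull (carrier (free_module R B)) (carrier (free_module R B'))"
proof (rule bij_betw_imageI)
  interpret R: cring R by (rule cring)
  show "inj_on pull (carrier (free_module R B))"
    using inj_on_subset[OF inj_on_pull free_module_supported[OF B(1)]] .
  show "pull ` carrier (free_module R B) = carrier (free_module R B')"
  proof (intro equalityI image_subsetI subsetI)
    fix w assume w: "w \<in> carrier (free_module R B)"
    have "{q. pull w q \<noteq> \<zero>\<^bsub>R\<^esub>} \<subseteq> {q \<in> L'. g q \<in> {p. w p \<noteq> \<zero>\<^bsub>R\<^esub>}}"
      by (auto simp: pull_def)
    moreover have "finite {q \<in> L'. g q \<in> {p. w p \<noteq> \<zero>\<^bsub>R\<^esub>}}"
      using w bij finite_inverse_image_gen[of "{p. w p \<noteq> \<zero>\<^bsub>R\<^esub>}" g L']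
      by (auto simp: free_module_def bij_betw_def)
    ultimately have "finite {q. pull w q \<noteq> \<zero>\<^bsub>R\<^esub>}"
      by (rule finite_subset)
    moreover have "pull w q = \<zero>\<^bsub>R\<^esub>" if "q \<notin> B'" for q
      using w B(3) that by (auto simp: free_module_def pull_def)
    moreover have "pull w q \<in> carrier R" for q
      using w by (auto simp: free_module_def pull_def)
    ultimately show "pull w \<in> carrier (free_module R B')"
      by (simp add: free_module_def)
  next
    fix u assume u: "u \<in> carrier (free_module R B')"
    \<comment> \<open>The preimage of \<open>u\<close>: transport along the inverse of
      \<open>g\<close>, extended by zero outside \<open>L\<close>.\<close>
    define w where "w p = (if p \<in> L then u (inv_into L' g p) else \<zero>\<^bsub>R\<^esub>)" for p
    have inv: "inv_into L' g (g q) = q" if "q \<in> L'" for q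
      using bij that by (simp add: bij_betw_inv_into_left)
    have ginv: "g (inv_into L' g p) = p \<and> inv_into L' g p \<in> L'" if "p \<in> L" for p
      using bij that by (auto simp: bij_betw_def f_inv_into_f intro: inv_into_into)
    have "{p. w p \<noteq> \<zero>\<^bsub>R\<^esub>} \<subseteq> g ` {q. u q \<noteq> \<zero>\<^bsub>R\<^esub>}"
    proof
      fix p assume "p \<in> {p. w p \<noteq> \<zero>\<^bsub>R\<^esub>}"
      then have "p = g (inv_into L' g p)" "u (inv_into L' g p) \<noteq> \<zero>\<^bsub>R\<^esub>"
        using ginv[of p] by (auto simp: w_def split: if_splits)
      then show "p \<in> g ` {q. u q \<noteq> \<zero>\<^bsub>R\<^esub>}" by blast
    qed
    moreover have "finite {q. u q \<noteq> \<zero>\<^bsub>R\<^esub>}" using u by (simp add: free_module_def)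
    ultimately have "finite {p. w p \<noteq> \<zero>\<^bsub>R\<^esub>}" by (meson finite_imageI finite_subset)
    moreover have "w p = \<zero>\<^bsub>R\<^esub>" if "p \<notin> B" for p
      using u that B(3)[of "inv_into L' g p"] ginv[of p] by (auto simp: w_def free_module_def)
    ultimately have "w \<in> carrier (free_module R B)"
      using u by (auto simp: w_def free_module_def)
    moreover have "pull w = u"
      using u B(2) g_in inv by (auto simp: pull_def w_def free_module_def fun_eq_iff)
    ultimately show "u \<in> pull ` carrier (free_module R B)" by blast
  qed
qed

lemma coeff_closed:
  "(\<Oplus>\<^bsub>R\<^esub>m\<in>{..<n::nat}. alt_sign R m \<otimes>\<^bsub>R\<^esub> basis_elem R (h m) q) \<in> carrier R"
proof -
  interpret R: cring R by (rule cring)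
  show ?thesis
    by (auto intro!: R.finsum_closed R.m_closed alt_sign_closed basis_elem_closed cring)
qed

text \<open>Faces of elements of \<open>L\<close> stay in \<open>L\<close>: such an element is
  \<open>g q'\<close>, and its faces are \<open>g\<close> applied to faces of \<open>q'\<close>,
  which lie in \<open>L'\<close>. Hence every coefficient outside \<open>L\<close> vanishes.\<close>

lemma face_diff_supported:
  assumes w: "w \<in> supported"
  shows "face_diff R k face w \<in> supported"
proof -
  interpret R: cring R by (rule cring)
  have "face_diff R k face w q = \<zero>\<^bsub>R\<^esub>" if "q \<notin> L" for q
    unfolding face_diff_def
  proof (rule finsum_all_zero[OF cring])
    fix p assume "p \<in> {p. w p \<noteq> \<zero>\<^bsub>R\<^esub>}"
    with w have "p \<in> L" by (auto simp: supported_def)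
    then obtain q' where q': "q' \<in> L'" "p = g q'" using bij by (auto simp: bij_betw_def)
    have "(\<Oplus>\<^bsub>R\<^esub>m\<in>{..<k p}. alt_sign R m \<otimes>\<^bsub>R\<^esub> basis_elem R (face m p) q) = \<zero>\<^bsub>R\<^esub>"
    proof (rule finsum_all_zero[OF cring])
      fix m assume "m \<in> {..<k p}"
      then have "face m p \<noteq> q"
        using q' k face face'_closed g_in that by (metis lessThan_iff)
      then show "alt_sign R m \<otimes>\<^bsub>R\<^esub> basis_elem R (face m p) q = \<zero>\<^bsub>R\<^esub>"
        by (auto simp: basis_elem_def alt_sign_closed cring)
    qed
    then show "w p \<otimes>\<^bsub>R\<^esub> (\<Oplus>\<^bsub>R\<^esub>m\<in>{..<k p}. alt_sign R m \<otimes>\<^bsub>R\<^esub> basis_elem R (face m p) q) = \<zero>\<^bsub>R\<^esub>"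
      using w by (simp add: supported_def)
  qed
  moreover have "face_diff R k face w q \<in> carrier R" for q
    using w by (auto simp: face_diff_def supported_def intro!: R.finsum_closed R.m_closed coeff_closed)
  ultimately show ?thesis by (simp add: supported_def)
qed

text \<open>The chain map property of \<open>pull\<close>. It comes from reindexing the outer sum
  along \<open>g\<close> and matching the inner sums face by face.\<close>

lemma pull_face_diff:
  assumes w: "w \<in> supported"
  shows "face_diff R k' face' (pull w) = pull (face_diff R k face w)"
proof
  interpret R: cring R by (rule cring)
  fix q
  have wR: "w p \<in> carrier R" for p using w by (simp add: supported_def)
  let ?S' = "{q. pull w q \<noteq> \<zero>\<^bsub>R\<^esub>}"
  let ?c = "\<lambda>p q. \<Oplus>\<^bsub>R\<^esub>m\<in>{..<k p}. alt_sign R m \<otimes>\<^bsub>R\<^esub> basis_elem R (face m p) q"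
  let ?c' = "\<lambda>p q. \<Oplus>\<^bsub>R\<^esub>m\<in>{..<k' p}. alt_sign R m \<otimes>\<^bsub>R\<^esub> basis_elem R (face' m p) q"
  have S': "?S' \<subseteq> L'" by (auto simp: pull_def)
  \<comment> \<open>The support of \<open>w\<close> lies in \<open>L\<close>, the image of
    \<open>g\<close>; this is what allows the outer sum to be reindexed.\<close>
  have gS': "{p. w p \<noteq> \<zero>\<^bsub>R\<^esub>} = g ` ?S'"
  proof (intro equalityI subsetI)
    fix p assume p: "p \<in> {p. w p \<noteq> \<zero>\<^bsub>R\<^esub>}"
    with w have "p \<in> L" by (auto simp: supported_def)
    then obtain q where "q \<in> L'" "p = g q" using bij by (auto simp: bij_betw_def)
    with p show "p \<in> g ` ?S'" by (auto simp: pull_def)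
  qed (auto simp: pull_def split: if_splits)
  show "face_diff R k' face' (pull w) q = pull (face_diff R k face w) q"
  proof (cases "q \<in> L'")
    case True
    have c: "?c (g p) (g q) = ?c' p q" if "p \<in> L'" for p
    proof -
      \<comment> \<open>The face of \<open>g p\<close> is \<open>g (face' m p)\<close>, and by
        injectivity of \<open>g\<close> it equals \<open>g q\<close> exactly when
        \<open>face' m p = q\<close>.\<close>
      have "basis_elem R (face m (g p)) (g q) = basis_elem R (face' m p) q" if "m < k' p" for m
        using \<open>p \<in> L'\<close> that True face face'_closed bij
        by (auto simp: basis_elem_def bij_betw_def inj_on_eq_iff)
      then show ?thesis
        using k[OF that]
        by (intro R.finsum_cong')
          (auto intro!: R.m_closed alt_sign_closed basis_elem_closed cring)
    qed
    have "pull (face_diff R k face w) q = (\<Oplus>\<^bsub>R\<^esub>p\<in>g ` ?S'. w p \<otimes>\<^bsub>R\<^esub> ?c p (g q))"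
      using True by (simp add: pull_def face_diff_def gS')
    also have "\<dots> = (\<Oplus>\<^bsub>R\<^esub>p\<in>?S'. w (g p) \<otimes>\<^bsub>R\<^esub> ?c (g p) (g q))"
      using S' bij
      by (intro R.finsum_reindex)
        (auto simp: bij_betw_def wR intro!: coeff_closed R.m_closed elim: inj_on_subset)
    also have "\<dots> = (\<Oplus>\<^bsub>R\<^esub>p\<in>?S'. pull w p \<otimes>\<^bsub>R\<^esub> ?c' p q)"
    proof (rule R.finsum_cong')
      fix p assume "p \<in> ?S'"
      with S' have "p \<in> L'" by auto
      with c show "w (g p) \<otimes>\<^bsub>R\<^esub> ?c (g p) (g q) = pull w p \<otimes>\<^bsub>R\<^esub> ?c' p q"
        by (simp add: pull_def)
    qed (auto simp: pull_def wR intro!: coeff_closed)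
    finally show ?thesis by (simp add: face_diff_def)
  next
    case False
    \<comment> \<open>Outside \<open>L'\<close> the pulled back function is zero by definition; the
      other side vanishes since all faces remain in \<open>L'\<close>.\<close>
    have "face_diff R k' face' (pull w) q = \<zero>\<^bsub>R\<^esub>"
      unfolding face_diff_def
    proof (rule finsum_all_zero[OF cring])
      fix p assume "p \<in> ?S'"
      with S' have p: "p \<in> L'" by auto
      have "?c' p q = \<zero>\<^bsub>R\<^esub>"
      proof (rule finsum_all_zero[OF cring])
        fix m assume "m \<in> {..<k' p}"
        with p False face'_closed have "face' m p \<noteq> q" by auto
        then show "alt_sign R m \<otimes>\<^bsub>R\<^esub> basis_elem R (face' m p) q = \<zero>\<^bsub>R\<^esub>"
          by (auto simp: basis_elem_def alt_sign_closed cring)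
      qed
      then show "pull w p \<otimes>\<^bsub>R\<^esub> ?c' p q = \<zero>\<^bsub>R\<^esub>"
        by (simp add: pull_def wR)
    qed
    with False show ?thesis by (simp add: pull_def)
  qed
qed

lemma pull_add: "pull (\<lambda>p. w p \<oplus>\<^bsub>R\<^esub> w' p) = (\<lambda>q. pull w q \<oplus>\<^bsub>R\<^esub> pull w' q)"
  by (rule ext) (simp add: pull_def cring.cring_simprules[OF cring])

lemma pull_smult: "r \<in> carrier R \<Longrightarrow> pull (\<lambda>p. r \<otimes>\<^bsub>R\<^esub> w p) = (\<lambda>q. r \<otimes>\<^bsub>R\<^esub> pull w q)"
  by (rule ext) (simp add: pull_def cring.cring_simprules[OF cring])

text \<open>The shift \<open>s\<close> is the change of degree under relabelling. Since
  \<open>pull\<close> is a chain map matching the bases \<open>B n\<close> and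
  \<open>B' (n + s)\<close>, it restricts to bijections of the \<open>Theta\<close> complexes, their
  cycles and their boundaries.\<close>

theorem homology_isomorphic:
  fixes B :: "int \<Rightarrow> 'b set" and B' :: "int \<Rightarrow> 'c set" and s :: int
  assumes d: "\<And>n w. w \<in> carrier (free_module R (B n)) \<Longrightarrow> d n w = face_diff R k face w"
    and d': "\<And>n w. w \<in> carrier (free_module R (B' n)) \<Longrightarrow> d' n w = face_diff R k' face' w"
    and B: "\<And>n. B n \<subseteq> L" and B': "\<And>n. B' n \<subseteq> L'"
    and g: "\<And>n q. q \<in> L' \<Longrightarrow> g q \<in> B n \<longleftrightarrow> q \<in> B' (n + s)"
  shows "mod_isomorphic R (homology (Theta (\<lambda>n. free_module R (B n)) d) d n)
           (homology (Theta (\<lambda>n. free_module R (B' n)) d') d' (n + s))"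
proof -
  interpret R: cring R by (rule cring)
  define A where "A n = carrier (free_module R (B n))" for n
  define A' where "A' n = carrier (free_module R (B' n))" for n
  define T where "T n = {w \<in> A n. d n w \<in> A (n - 1)}" for n
  define T' where "T' n = {w \<in> A' n. d' n w \<in> A' (n - 1)}" for n
  have bijA: "bij_betw pull (A n) (A' (n + s))" for n
    unfolding A_def A'_def by (rule bij_betw_pull[OF B B' g])
  have AS: "A n \<subseteq> supported" for n
    unfolding A_def by (rule free_module_supported[OF B])
  have dS: "d n w \<in> supported" if "w \<in> A n" for n w
    using that d[of w n] face_diff_supported[of w] AS[of n] by (auto simp: A_def)
  have pull_d: "d' (n + s) (pull w) = pull (d n w)" if "w \<in> A n" for n w
    using d[of w n] d'[of "pull w" "n + s"] that bij_betwE[OF bijA[of n]] pull_face_diff[of w] AS[of n]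
    by (auto simp: A_def A'_def)
  \<comment> \<open>This is applied to \<open>d n w\<close>, which need not lie in
    \<open>A (n - 1)\<close>; injectivity on the larger set \<open>supported\<close> makes
    membership equivalent on both sides.\<close>
  have mem_A: "pull w \<in> A' (n + s) \<longleftrightarrow> w \<in> A n" if "w \<in> supported" for w n
    unfolding bij_betw_imp_surj_on[OF bijA, symmetric]
    by (rule inj_on_image_mem_iff[OF inj_on_pull that AS])
  have zero: "(\<lambda>p. \<zero>\<^bsub>R\<^esub>) \<in> supported" and pull_zero: "pull (\<lambda>p. \<zero>\<^bsub>R\<^esub>) = (\<lambda>p. \<zero>\<^bsub>R\<^esub>)"
    by (auto simp: supported_def pull_def)
  have T_iff: "d' (n + s) (pull w) \<in> A' (n + s - 1) \<longleftrightarrow> d n w \<in> A (n - 1)" if "w \<in> A n" for n w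
    using mem_A[OF dS[OF that], of "n - 1"] pull_d[OF that] by (simp add: algebra_simps)
  have bijT: "bij_betw pull (T n) (T' (n + s))" for n
    unfolding T_def T'_def by (rule bij_betw_Collect[OF bijA]) (rule T_iff)
  have Z_iff: "d' (n + s) (pull w) = (\<lambda>p. \<zero>\<^bsub>R\<^esub>) \<longleftrightarrow> d n w = (\<lambda>p. \<zero>\<^bsub>R\<^esub>)" if "w \<in> T n" for w
  proof -
    have "w \<in> A n" using that by (simp add: T_def)
    then show ?thesis
      using inj_on_eq_iff[OF inj_on_pull dS[of w n] zero] by (simp add: pull_d pull_zero)
  qed
  have bijZ: "bij_betw pull {w \<in> T n. d n w = (\<lambda>p. \<zero>\<^bsub>R\<^esub>)}
                            {w \<in> T' (n + s). d' (n + s) w = (\<lambda>p. \<zero>\<^bsub>R\<^esub>)}"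
    by (rule bij_betw_Collect[OF bijT]) (rule Z_iff)
  \<comment> \<open>By \<open>pull_d\<close>, pulling back boundaries is the same as applying
    \<open>d'\<close> to pulled back elements of \<open>T (n + 1)\<close>, and these fill the
    corresponding \<open>T'\<close>.\<close>
  have boundaries: "pull ` d (n + 1) ` T (n + 1) = d' (n + s + 1) ` T' (n + s + 1)"
  proof -
    have "pull ` d (n + 1) ` T (n + 1) = d' (n + 1 + s) ` pull ` T (n + 1)"
      unfolding image_image by (rule image_cong) (auto simp: T_def pull_d)
    then show ?thesis
      using bij_betw_imp_surj_on[OF bijT[of "n + 1"]] by (simp add: algebra_simps)
  qed
  have "mod_isomorphic R
    (quot_module ((free_module R (B n))
       \<lparr>carrier := {w \<in> T n. d n w = (\<lambda>p. \<zero>\<^bsub>R\<^esub>)}\<rparr>) (d (n + 1) ` T (n + 1)))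
    (quot_module ((free_module R (B' (n + s)))
       \<lparr>carrier := {w \<in> T' (n + s). d' (n + s) w = (\<lambda>p. \<zero>\<^bsub>R\<^esub>)}\<rparr>)
       (d' (n + s + 1) ` T' (n + s + 1)))"
  proof (rule quot_module_isomorphic[where f = pull and S = supported])
    show "d (n + 1) ` T (n + 1) \<subseteq> supported" using dS by (auto simp: T_def)
    show "carrier ((free_module R (B n))\<lparr>carrier := {w \<in> T n. d n w = (\<lambda>p. \<zero>\<^bsub>R\<^esub>)}\<rparr>) \<subseteq> supported"
      using AS by (auto simp: T_def)
  qed (use bijZ boundaries inj_on_pull in
        \<open>simp_all add: supported_def pull_add pull_smult free_module_def\<close>)
  then show ?thesis
    by (simp add: homology_def Theta_def T_def T'_def A_def A'_def free_module_def)
qed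

end

section \<open>Cluster, tail and head complexes\<close>

lemma length_omit: "m < length p \<Longrightarrow> length (omit m p) = length p - 1"
  by (auto simp: omit_def)

lemma set_omit: "set (omit m p) \<subseteq> set p"
  using set_take_subset set_drop_subset by (fastforce simp: omit_def)

lemma hd_omit: "p \<noteq> [] \<Longrightarrow> hd (omit (Suc m) p) = hd p"
  by (cases p) (auto simp: omit_def)

lemma last_omit: "Suc m < length p \<Longrightarrow> last (omit m p) = last p"
  by (simp add: omit_def)

lemma omit_nonempty: "1 < length p \<Longrightarrow> omit m p \<noteq> []"
  by (cases p; cases "tl p") (auto simp: omit_def take_Cons')

lemma omit_snoc: "m < length q \<Longrightarrow> omit m (q @ [a]) = omit m q @ [a]"
  by (simp add: omit_def)

lemma omit_Suc_Cons: "omit (Suc m) (a # q) = a # omit m q"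
  by (simp add: omit_def)

lemma omit_elem_paths:
  assumes "p \<in> elem_paths V n" "m < length p" "1 < length p"
  shows "omit m p \<in> elem_paths V (n - 1)"
  using assms length_omit[of m p] set_omit[of m p] by (auto simp: elem_paths_def)

text \<open>Only inner vertices are omitted, so tail and head survive. A face exists only if
  \<open>length p\<close> is at least 3, which gives the condition \<open>1 \<le> n - 1\<close> of
  the target. A face may fail to be allowed, but it is an elementary path.\<close>

lemma d_cluster_eq:
  assumes "cring R" "w \<in> carrier (free_module R {p \<in> allowed_paths G n. 1 \<le> n \<and> hd p = x \<and> last p = y})"
  shows "d_cluster R (pverts G) x y n w
         = face_diff R (\<lambda>p. length p - 2) (\<lambda>m. omit (Suc m)) w"
  unfolding d_cluster_def Let_def Lambda_cluster_def
proof (rule lin_ext_eq_face_diff[OF assms])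
  fix p m
  assume "p \<in> {p \<in> allowed_paths G n. 1 \<le> n \<and> hd p = x \<and> last p = y}" "m < length p - 2"
  then show "omit (Suc m) p \<in> {p \<in> elem_paths (pverts G) (n - 1). 1 \<le> n - 1 \<and> hd p = x \<and> last p = y}"
    using omit_elem_paths[of p "pverts G" n "Suc m"] hd_omit[of p m] last_omit[of "Suc m" p]
    by (auto simp: allowed_paths_def elem_paths_def)
qed

lemma d_tail_eq:
  assumes "cring R" "w \<in> carrier (free_module R {p \<in> allowed_paths G n. hd p = x})"
  shows "d_tail R (pverts G) x n w
         = face_diff R (\<lambda>p. length p - 1) (\<lambda>m. omit (Suc m)) w"
  unfolding d_tail_def Let_def Lambda_tail_def
proof (rule lin_ext_eq_face_diff[OF assms])
  fix p m
  assume "p \<in> {p \<in> allowed_paths G n. hd p = x}" "m < length p - 1"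
  then show "omit (Suc m) p \<in> {p \<in> elem_paths (pverts G) (n - 1). hd p = x}"
    using omit_elem_paths[of p "pverts G" n "Suc m"] hd_omit[of p m]
    by (cases "p = []") (auto simp: allowed_paths_def elem_paths_def)
qed

lemma d_head_eq:
  assumes "cring R" "w \<in> carrier (free_module R {p \<in> allowed_paths G n. last p = x})"
  shows "d_head R (pverts G) x n w = face_diff R (\<lambda>p. length p - 1) omit w"
  unfolding d_head_def Let_def Lambda_head_def
proof (rule lin_ext_eq_face_diff[OF assms])
  fix p m
  assume "p \<in> {p \<in> allowed_paths G n. last p = x}" "m < length p - 1"
  then show "omit m p \<in> {p \<in> elem_paths (pverts G) (n - 1). last p = x}"
    using omit_elem_paths[of p "pverts G" n m] last_omit[of m p]
    by (auto simp: allowed_paths_def)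
qed

section \<open>New vertices\<close>

text \<open>Taking \<open>T\<close> to be \<open>{a}\<close> or \<open>{a, b}\<close> yields the
  cone or the suspension, so both are treated at once; likewise for the inverse
  constructions.\<close>

definition multi_cone :: "'v set \<Rightarrow> 'v pair_pre_digraph \<Rightarrow> 'v pair_pre_digraph" where
  "multi_cone T G = \<lparr> pverts = T \<union> pverts G, parcs = parcs G \<union> pverts G \<times> T \<rparr>"

definition inv_multi_cone :: "'v set \<Rightarrow> 'v pair_pre_digraph \<Rightarrow> 'v pair_pre_digraph" where
  "inv_multi_cone T G = \<lparr> pverts = T \<union> pverts G, parcs = parcs G \<union> T \<times> pverts G \<rparr>"

text \<open>New vertices have no outgoing arrows, and every old vertex has an arrow to
  \<open>a\<close>. The case \<open>q = []\<close> is excluded because \<open>[a]\<close> is an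
  allowed 0-path whereas \<open>[]\<close> is no path.\<close>

lemma snoc_allowed_multi_cone:
  assumes "pair_digraph G" "T \<inter> pverts G = {}" "a \<in> T" "q \<noteq> []"
  shows "q @ [a] \<in> allowed_paths (multi_cone T G) n \<longleftrightarrow> q \<in> allowed_paths G (n - 1)"
proof -
  interpret pair_digraph G by fact
  let ?E = "\<lambda>u w. (u, w) \<in> parcs G" and ?E' = "\<lambda>u w. (u, w) \<in> parcs (multi_cone T G)"
  have E': "?E' u w \<longleftrightarrow> ?E u w" if "w \<in> pverts G" for u w
    using that assms(2) by (auto simp: multi_cone_def)
  have T: "?E' u a \<longleftrightarrow> u \<in> pverts G" for u
    using assms(2,3) by (auto simp: multi_cone_def dest: in_arcsD2)
  have E: "u \<in> pverts G" if "?E u w" for u w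
    using that by (auto dest: in_arcsD1)
  \<comment> \<open>Oldness travels backwards: the arrow to \<open>a\<close> forces the last vertex
    of \<open>q\<close> to be old, and an arrow into an old vertex is an arrow of \<open>G\<close>,
    so its source is old.\<close>
  have "successively ?E' q \<and> ?E' (last q) a \<longleftrightarrow> successively ?E q \<and> set q \<subseteq> pverts G"
    using \<open>q \<noteq> []\<close>
  proof (induction q rule: induct_list012)
    case (3 x y zs)
    then show ?case using E E' by auto
  qed (auto simp: T)
  then show ?thesis
    using assms(3,4)
    by (auto simp: allowed_paths_def elem_paths_def successively_append_iff multi_cone_def)
qed

lemma Cons_allowed_inv_multi_cone:
  assumes "pair_digraph G" "T \<inter> pverts G = {}" "a \<in> T" "q \<noteq> []"
  shows "a # q \<in> allowed_paths (inv_multi_cone T G) n \<longleftrightarrow> q \<in> allowed_paths G (n - 1)"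
proof -
  interpret pair_digraph G by fact
  let ?E = "\<lambda>u w. (u, w) \<in> parcs G" and ?E' = "\<lambda>u w. (u, w) \<in> parcs (inv_multi_cone T G)"
  have E': "?E' u w \<longleftrightarrow> ?E u w" if "u \<in> pverts G" for u w
    using that assms(2) by (auto simp: inv_multi_cone_def)
  have T: "?E' a w \<longleftrightarrow> w \<in> pverts G" for w
    using assms(2,3) by (auto simp: inv_multi_cone_def dest: in_arcsD1)
  have E: "w \<in> pverts G" if "?E u w" for u w
    using that by (auto dest: in_arcsD2)
  \<comment> \<open>Here oldness travels forwards, since arrows out of old vertices are arrows of
    \<open>G\<close>. The starting condition on \<open>hd q\<close> is supplied by the arrow from
    \<open>a\<close>.\<close>
  have "successively ?E' q \<longleftrightarrow> successively ?E q \<and> set q \<subseteq> pverts G" if "hd q \<in> pverts G"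
    using \<open>q \<noteq> []\<close> that
  proof (induction q rule: induct_list012)
    case (3 x y zs)
    then show ?case using E[of x y] E'[of x y] by auto
  qed auto
  then have "successively ?E' (a # q) \<longleftrightarrow> successively ?E q \<and> set q \<subseteq> pverts G"
    using T \<open>q \<noteq> []\<close> by (cases q) auto
  then show ?thesis
    using assms(3,4) by (auto simp: allowed_paths_def elem_paths_def inv_multi_cone_def)
qed

text \<open>The case of shift 0. As the degree is the same on both sides, so is the condition
  \<open>1 \<le> n\<close>, and only allowedness and end points remain to be compared.\<close>

lemma H_cluster_isomorphic:
  fixes s :: int
  assumes "relabelling R L (\<lambda>p. length p - 2) (\<lambda>m. omit (Suc m))
             L' (\<lambda>p. length p - 2) (\<lambda>m. omit (Suc m)) g"
    and "\<And>n. {p \<in> allowed_paths G n. 1 \<le> n \<and> hd p = x \<and> last p = y} \<subseteq> L"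
    and "\<And>n. {p \<in> allowed_paths G' n. 1 \<le> n \<and> hd p = x' \<and> last p = y'} \<subseteq> L'"
    and "\<And>n p. p \<in> L' \<Longrightarrow> g p \<in> allowed_paths G n \<and> hd (g p) = x \<and> last (g p) = y \<longleftrightarrow>
           p \<in> allowed_paths G' n \<and> hd p = x' \<and> last p = y'"
  shows "mod_isomorphic R (H_cluster R G x y n) (H_cluster R G' x' y' n)"
proof -
  interpret relabelling R L "\<lambda>p. length p - 2" "\<lambda>m. omit (Suc m)"
    L' "\<lambda>p. length p - 2" "\<lambda>m. omit (Suc m)" g by fact
  let ?B = "\<lambda>G x y n. {p \<in> allowed_paths G n. 1 \<le> n \<and> hd p = x \<and> last p = y}"
  have "mod_isomorphic R
    (homology (Theta (\<lambda>n. free_module R (?B G x y n)) (d_cluster R (pverts G) x y))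
       (d_cluster R (pverts G) x y) n)
    (homology (Theta (\<lambda>n. free_module R (?B G' x' y' n)) (d_cluster R (pverts G') x' y'))
       (d_cluster R (pverts G') x' y') (n + 0))"
  proof (rule homology_isomorphic)
    show "g p \<in> ?B G x y n \<longleftrightarrow> p \<in> ?B G' x' y' (n + 0)" if "p \<in> L'" for n p
      using assms(4)[OF that, of n] by auto
  qed (assumption | rule assms(2,3) d_cluster_eq cring)+
  then show ?thesis
    by (simp add: H_cluster_def A_cluster_def[abs_def])
qed

section \<open>Relabellings of end vertices and the resulting isomorphisms\<close>

lemma allowed_paths_snoc:
  "{p \<in> allowed_paths G n. 1 \<le> n \<and> hd p = x \<and> last p = a} \<subseteq> {q @ [a] |q. q \<noteq> []}"
proof
  fix p assume "p \<in> {p \<in> allowed_paths G n. 1 \<le> n \<and> hd p = x \<and> last p = a}"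
  then show "p \<in> {q @ [a] |q. q \<noteq> []}"
    \<comment> \<open>The condition \<open>1 \<le> n\<close> forces at least two vertices, so
      something remains in front of \<open>a\<close>.\<close>
    by (cases p rule: rev_cases) (auto simp: allowed_paths_def elem_paths_def)
qed

lemma allowed_paths_Cons:
  "{p \<in> allowed_paths G n. 1 \<le> n \<and> hd p = a \<and> last p = x} \<subseteq> {a # q |q. q \<noteq> []}"
proof
  fix p assume "p \<in> {p \<in> allowed_paths G n. 1 \<le> n \<and> hd p = a \<and> last p = x}"
  then show "p \<in> {a # q |q. q \<noteq> []}"
    by (cases p) (auto simp: allowed_paths_def elem_paths_def)
qed

lemma relabelling_snoc_snoc:
  assumes "cring R"
  shows "relabelling R {q @ [a] |q. q \<noteq> []} (\<lambda>p. length p - 2) (\<lambda>m. omit (Suc m))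
           {q @ [a'] |q. q \<noteq> []} (\<lambda>p. length p - 2) (\<lambda>m. omit (Suc m)) (\<lambda>p. butlast p @ [a])"
proof (rule relabelling.intro)
  show "bij_betw (\<lambda>p. butlast p @ [a]) {q @ [a'] |q. q \<noteq> []} {q @ [a] |q. q \<noteq> []}"
    by (rule bij_betw_byWitness[where f' = "\<lambda>p. butlast p @ [a']"]) fastforce+
qed (use assms in \<open>fastforce simp: omit_snoc omit_nonempty\<close>)+

text \<open>The inner positions of \<open>q @ [a]\<close> are the positions of \<open>q\<close>
  other than the first. So face counts, positions and signs agree.\<close>

lemma relabelling_snoc:
  assumes "cring R"
  shows "relabelling R {q @ [a] |q. q \<noteq> []} (\<lambda>p. length p - 2) (\<lambda>m. omit (Suc m))
           {q. q \<noteq> []} (\<lambda>q. length q - 1) (\<lambda>m. omit (Suc m)) (\<lambda>q. q @ [a])"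
proof (rule relabelling.intro)
  show "bij_betw (\<lambda>q. q @ [a]) {q. q \<noteq> []} {q @ [a] |q. q \<noteq> []}"
    by (rule bij_betw_byWitness[where f' = butlast]) fastforce+
qed (use assms in \<open>fastforce simp: omit_snoc omit_nonempty\<close>)+

lemma relabelling_Cons_Cons:
  assumes "cring R"
  shows "relabelling R {a # q |q. q \<noteq> []} (\<lambda>p. length p - 2) (\<lambda>m. omit (Suc m))
           {a' # q |q. q \<noteq> []} (\<lambda>p. length p - 2) (\<lambda>m. omit (Suc m)) (\<lambda>p. a # tl p)"
proof (rule relabelling.intro)
  show "bij_betw (\<lambda>p. a # tl p) {a' # q |q. q \<noteq> []} {a # q |q. q \<noteq> []}"
    by (rule bij_betw_byWitness[where f' = "\<lambda>p. a' # tl p"]) fastforce+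
qed (use assms in \<open>fastforce simp: omit_Suc_Cons omit_nonempty\<close>)+

text \<open>Position \<open>Suc m\<close> of \<open>a # q\<close> is position \<open>m\<close> of
  \<open>q\<close>, which explains the unshifted \<open>omit\<close> of the head differential; the
  sign depends on \<open>m\<close> in both cases.\<close>

lemma relabelling_Cons:
  assumes "cring R"
  shows "relabelling R {a # q |q. q \<noteq> []} (\<lambda>p. length p - 2) (\<lambda>m. omit (Suc m))
           {q. q \<noteq> []} (\<lambda>q. length q - 1) omit (\<lambda>q. a # q)"
proof (rule relabelling.intro)
  show "bij_betw (\<lambda>q. a # q) {q. q \<noteq> []} {a # q |q. q \<noteq> []}"
    by (rule bij_betw_byWitness[where f' = tl]) fastforce+
qed (use assms in \<open>fastforce simp: omit_Suc_Cons omit_nonempty\<close>)+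

text \<open>Both allowedness conditions reduce to that of the same \<open>q\<close> in
  \<open>G\<close>. With \<open>T\<close> and \<open>T'\<close> independent, this covers two apexes
  of one suspension as well as suspension against cone.\<close>

lemma H_cluster_multi_cone_isomorphic:
  assumes R: "cring R" and G: "pair_digraph G"
    and T: "T \<inter> pverts G = {}" "a \<in> T" and T': "T' \<inter> pverts G = {}" "a' \<in> T'"
  shows "mod_isomorphic R (H_cluster R (multi_cone T G) v a n) (H_cluster R (multi_cone T' G) v a' n)"
proof (rule H_cluster_isomorphic[OF relabelling_snoc_snoc[OF R]])
  show "butlast p @ [a] \<in> allowed_paths (multi_cone T G) n \<and> hd (butlast p @ [a]) = v
          \<and> last (butlast p @ [a]) = a \<longleftrightarrow>
        p \<in> allowed_paths (multi_cone T' G) n \<and> hd p = v \<and> last p = a'"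
    if "p \<in> {q @ [a'] |q. q \<noteq> []}" for n p
  proof -
    from that obtain q where "p = q @ [a']" "q \<noteq> []" by blast
    then show ?thesis
      by (simp add: snoc_allowed_multi_cone[OF G T] snoc_allowed_multi_cone[OF G T'])
  qed
qed (rule allowed_paths_snoc)+

text \<open>Removing the final \<open>a\<close> shortens a path by one, hence the shift -1. In
  degree 0 both bases are empty: the left one by \<open>1 \<le> n\<close>, the right one because
  there are no paths of degree -1.\<close>

lemma H_cluster_multi_cone_tail:
  assumes R: "cring R" and G: "pair_digraph G"
    and T: "T \<inter> pverts G = {}" "a \<in> T"
  shows "mod_isomorphic R (H_cluster R (multi_cone T G) v a n) (H_tail R G v (n - 1))"
proof -
  let ?C = "multi_cone T G"
  have "mod_isomorphic R
    (homology (Theta (\<lambda>n. free_module R {p \<in> allowed_paths ?C n. 1 \<le> n \<and> hd p = v \<and> last p = a})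
       (d_cluster R (pverts ?C) v a)) (d_cluster R (pverts ?C) v a) n)
    (homology (Theta (\<lambda>n. free_module R {p \<in> allowed_paths G n. hd p = v})
       (d_tail R (pverts G) v)) (d_tail R (pverts G) v) (n + - 1))"
  proof (rule relabelling.homology_isomorphic[OF relabelling_snoc[OF R]])
    show "q @ [a] \<in> {p \<in> allowed_paths ?C n. 1 \<le> n \<and> hd p = v \<and> last p = a} \<longleftrightarrow>
          q \<in> {p \<in> allowed_paths G (n + - 1). hd p = v}" if "q \<in> {q. q \<noteq> []}" for n q
      using that snoc_allowed_multi_cone[OF G T, of q n]
      by (auto simp: allowed_paths_def elem_paths_def Suc_le_eq)
    show "{p \<in> allowed_paths G n. hd p = v} \<subseteq> {q. q \<noteq> []}" for n
      by (auto simp: allowed_paths_def elem_paths_def)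
  qed (assumption | rule allowed_paths_snoc d_cluster_eq d_tail_eq R)+
  then show ?thesis
    unfolding H_cluster_def H_tail_def A_cluster_def[abs_def] A_tail_def[abs_def] by simp
qed

lemma H_cluster_inv_multi_cone_isomorphic:
  assumes R: "cring R" and G: "pair_digraph G"
    and T: "T \<inter> pverts G = {}" "a \<in> T" and T': "T' \<inter> pverts G = {}" "a' \<in> T'"
  shows "mod_isomorphic R (H_cluster R (inv_multi_cone T G) a v n)
           (H_cluster R (inv_multi_cone T' G) a' v n)"
proof (rule H_cluster_isomorphic[OF relabelling_Cons_Cons[OF R]])
  show "a # tl p \<in> allowed_paths (inv_multi_cone T G) n \<and> hd (a # tl p) = a
          \<and> last (a # tl p) = v \<longleftrightarrow>
        p \<in> allowed_paths (inv_multi_cone T' G) n \<and> hd p = a' \<and> last p = v"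
    if "p \<in> {a' # q |q. q \<noteq> []}" for n p
  proof -
    from that obtain q where "p = a' # q" "q \<noteq> []" by blast
    then show ?thesis
      by (simp add: Cons_allowed_inv_multi_cone[OF G T] Cons_allowed_inv_multi_cone[OF G T'])
  qed
qed (rule allowed_paths_Cons)+

lemma H_cluster_inv_multi_cone_head:
  assumes R: "cring R" and G: "pair_digraph G"
    and T: "T \<inter> pverts G = {}" "a \<in> T"
  shows "mod_isomorphic R (H_cluster R (inv_multi_cone T G) a v n) (H_head R G v (n - 1))"
proof -
  let ?C = "inv_multi_cone T G"
  have "mod_isomorphic R
    (homology (Theta (\<lambda>n. free_module R {p \<in> allowed_paths ?C n. 1 \<le> n \<and> hd p = a \<and> last p = v})
       (d_cluster R (pverts ?C) a v)) (d_cluster R (pverts ?C) a v) n)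
    (homology (Theta (\<lambda>n. free_module R {p \<in> allowed_paths G n. last p = v})
       (d_head R (pverts G) v)) (d_head R (pverts G) v) (n + - 1))"
  proof (rule relabelling.homology_isomorphic[OF relabelling_Cons[OF R]])
    show "a # q \<in> {p \<in> allowed_paths ?C n. 1 \<le> n \<and> hd p = a \<and> last p = v} \<longleftrightarrow>
          q \<in> {p \<in> allowed_paths G (n + - 1). last p = v}" if "q \<in> {q. q \<noteq> []}" for n q
      using that Cons_allowed_inv_multi_cone[OF G T, of q n]
      by (auto simp: allowed_paths_def elem_paths_def Suc_le_eq)
    show "{p \<in> allowed_paths G n. last p = v} \<subseteq> {q. q \<noteq> []}" for n
      by (auto simp: allowed_paths_def elem_paths_def)
  qed (assumption | rule allowed_paths_Cons d_cluster_eq d_head_eq R)+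
  then show ?thesis
    unfolding H_cluster_def H_head_def A_cluster_def[abs_def] A_head_def[abs_def] by simp
qed

lemma cone_eq: "cone a G = multi_cone {a} G"
  and inv_cone_eq: "inv_cone a G = inv_multi_cone {a} G"
  and suspension_eq: "suspension a b G = multi_cone {a, b} G"
  and inv_suspension_eq: "inv_suspension a b G = inv_multi_cone {a, b} G"
  by (simp_all add: cone_def inv_cone_def suspension_def inv_suspension_def multi_cone_def
      inv_multi_cone_def)

theorem theorem6p10:
  fixes R :: "('r, 'm) ring_scheme" and G :: "'v pair_pre_digraph"
  assumes "cring R"
    and "pair_digraph G" and "pverts G \<noteq> {}"
  shows
    "(\<forall>a. a \<notin> pverts G \<longrightarrow>
       (\<forall>v \<in> pverts G. \<forall>n::int. 0 \<le> n \<longrightarrow>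
          mod_isomorphic R (H_cluster R (cone a G) v a n) (H_tail R G v (n - 1)) \<and>
          mod_isomorphic R (H_cluster R (inv_cone a G) a v n) (H_head R G v (n - 1)))) \<and>
     (\<forall>a b. a \<notin> pverts G \<longrightarrow> b \<notin> pverts G \<longrightarrow> a \<noteq> b \<longrightarrow>
       (\<forall>v \<in> pverts G. \<forall>n::int. 0 \<le> n \<longrightarrow>
          mod_isomorphic R (H_cluster R (suspension a b G) v a n)
                           (H_cluster R (suspension a b G) v b n) \<and>
          mod_isomorphic R (H_cluster R (suspension a b G) v b n)
                           (H_cluster R (cone a G) v a n) \<and>
          mod_isomorphic R (H_cluster R (cone a G) v a n)
                           (H_tail R G v (n - 1)) \<and>
          mod_isomorphic R (H_cluster R (inv_suspension a b G) a v n)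
                           (H_cluster R (inv_suspension a b G) b v n) \<and>
          mod_isomorphic R (H_cluster R (inv_suspension a b G) b v n)
                           (H_cluster R (inv_cone a G) a v n) \<and>
          mod_isomorphic R (H_cluster R (inv_cone a G) a v n)
                           (H_head R G v (n - 1))))"
  \<comment> \<open>Each chain of isomorphisms exchanges \<open>a\<close> for \<open>b\<close>
    within \<open>{a, b}\<close>, then passes from \<open>{a, b}\<close> to \<open>{a}\<close>, and
    finally removes the apex.\<close>
  unfolding cone_eq inv_cone_eq suspension_eq inv_suspension_eq
  by (intro conjI allI ballI impI H_cluster_multi_cone_tail H_cluster_inv_multi_cone_head
      H_cluster_multi_cone_isomorphic H_cluster_inv_multi_cone_isomorphic assms(1,2)) auto

end
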